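(* Let $G$ be a finite simple undirected graph and $x\in V_G$. Then \[\tfrac12\operatorname{nlcw}(G)\le\operatorname{nlcw}(LC(G,x))\le 2\operatorname{nlcw}(G)\quad\text{and}\quad \tfrac13\operatorname{cw}(G)\le\operatorname{cw}(LC(G,x))\le 3\operatorname{cw}(G).\]
   Context: Local complementation: $LC(G,x)$ has vertex set $V_G$ and is obtained from $G$ by replacing the subgraph induced by $N_G(x)$ (the neighbors of $x$) by its edge complement: for distinct $y,z\in N_G(x)$, $\{y,z\}$ is an edge of $LC(G,x)$ iff it is not an edge of $G$; all other adjacencies are unchanged. Clique-width: for a positive integer $k$, $\mathrm{CW}_k$ is the smallest class of graphs whose vertices carry labels from $\{1,\dots,k\}$ that contains every single-vertex graph with any label and is closed under: disjoint union; relabeling $\rho_{a\to b}$ for $a\neq b$; and $\eta_{a,b}$ for $a\neq b$ (add all edges between vertices labeled $a$ and vertices labeled $b$). $\operatorname{cw}(G)$ is the least $k$ such that some labeling of $G$ lies in $\mathrm{CW}_k$. NLC-width: $\mathrm{NLC}_k$ is the smallest class of labeled graphs (labels in $\{1,\dots,k\}$) containing every single-vertex graph with any label and closed under: $G\times_S J$ for $S\subseteq\{1,\dots,k\}^2$ (disjoint union of vertex-disjoint $G$ and $J$ plus all edges $\{u,v\}$, $u\in V_G$, $v\in V_J$, $(\mathrm{lab}(u),\mathrm{lab}(v))\in S$); and $\circ_R$ for $R:\{1,\dots,k\}\to\{1,\dots,k\}$. $\operatorname{nlcw}(G)$ is the least $k$ such that some labeling of $G$ lies in $\mathrm{NLC}_k$.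 *)

theory Defs
  imports Complex_Main "HOL-Library.FuncSet"
begin

type_synonym 'a graph = "'a set \<times> 'a set set"

abbreviation verts :: "'a graph \<Rightarrow> 'a set" where "verts \<equiv> fst"
abbreviation edges :: "'a graph \<Rightarrow> 'a set set" where "edges \<equiv> snd"

definition simple_graph :: "'a graph \<Rightarrow> bool" where
  "simple_graph G \<longleftrightarrow>
     edges G \<subseteq> {{u, v} | u v. u \<in> verts G \<and> v \<in> verts G \<and> u \<noteq> v}"

definition finite_simple_graph :: "'a graph \<Rightarrow> bool" where
  "finite_simple_graph G \<longleftrightarrow> finite (verts G) \<and> simple_graph G"

definition neighbors :: "'a graph \<Rightarrow> 'a \<Rightarrow> 'a set" where
  "neighbors G x = {y \<in> verts G. {x, y} \<in> edges G}"

definition LC :: "'a graph \<Rightarrow> 'a \<Rightarrow> 'a graph" where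
  "LC G x =
     (verts G,
      {{y, z} | y z. y \<in> verts G \<and> z \<in> verts G \<and> y \<noteq> z \<and>
         (if y \<in> neighbors G x \<and> z \<in> neighbors G x
          then {y, z} \<notin> edges G else {y, z} \<in> edges G)})"

text \<open>
  A labeled graph is a graph together with a function on its vertices. The function is total in HOL;
  the rules below constrain it only on the vertex set, so its values elsewhere are irrelevant.
\<close>

inductive CW :: "nat \<Rightarrow> 'a graph \<Rightarrow> ('a \<Rightarrow> nat) \<Rightarrow> bool" for k :: nat where
  vertex: "lab v \<in> {1..k} \<Longrightarrow> CW k ({v}, {}) lab"
| disjoint_union:
    "\<lbrakk>CW k (V1, E1) lab1; CW k (V2, E2) lab2; V1 \<inter> V2 = {};
      \<And>v. v \<in> V1 \<Longrightarrow> lab v = lab1 v; \<And>v. v \<in> V2 \<Longrightarrow> lab v = lab2 v\<rbrakk>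
     \<Longrightarrow> CW k (V1 \<union> V2, E1 \<union> E2) lab"
| relabel:
    "\<lbrakk>CW k (V, E) lab; a \<in> {1..k}; b \<in> {1..k}; a \<noteq> b;
      \<And>v. v \<in> V \<Longrightarrow> lab' v = (if lab v = a then b else lab v)\<rbrakk>
     \<Longrightarrow> CW k (V, E) lab'"
| add_edges:
    "\<lbrakk>CW k (V, E) lab; a \<in> {1..k}; b \<in> {1..k}; a \<noteq> b\<rbrakk>
     \<Longrightarrow> CW k (V, E \<union> {{u, v} | u v. u \<in> V \<and> v \<in> V \<and> lab u = a \<and> lab v = b}) lab"

definition cw :: "'a graph \<Rightarrow> nat" where
  "cw G = (LEAST k. k \<ge> 1 \<and> (\<exists>lab. CW k G lab))"

inductive NLC :: "nat \<Rightarrow> 'a graph \<Rightarrow> ('a \<Rightarrow> nat) \<Rightarrow> bool" for k :: nat where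
  vertex: "lab v \<in> {1..k} \<Longrightarrow> NLC k ({v}, {}) lab"
| join:
    "\<lbrakk>NLC k (V1, E1) lab1; NLC k (V2, E2) lab2; V1 \<inter> V2 = {}; S \<subseteq> {1..k} \<times> {1..k};
      \<And>v. v \<in> V1 \<Longrightarrow> lab v = lab1 v; \<And>v. v \<in> V2 \<Longrightarrow> lab v = lab2 v\<rbrakk>
     \<Longrightarrow> NLC k (V1 \<union> V2,
          E1 \<union> E2 \<union> {{u, v} | u v. u \<in> V1 \<and> v \<in> V2 \<and> (lab1 u, lab2 v) \<in> S}) lab"
| relabel:
    "\<lbrakk>NLC k (V, E) lab; R \<in> {1..k} \<rightarrow> {1..k}; \<And>v. v \<in> V \<Longrightarrow> lab' v = R (lab v)\<rbrakk>
     \<Longrightarrow> NLC k (V, E) lab'"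

definition nlcw :: "'a graph \<Rightarrow> nat" where
  "nlcw G = (LEAST k. k \<ge> 1 \<and> (\<exists>lab. NLC k G lab))"

end

theory Submission
  imports Defs
begin

text \<open>
  Write \<open>N\<close> for the neighborhood of \<open>x\<close>. In an expression for \<open>G\<close>, each label is doubled
  so that it also records membership in \<open>N\<close>. For NLC-width this suffices: at every join the
  prescribed edges between the two \<open>N\<close>-parts are complemented.

  Clique-width operations cannot treat the two sides of a disjoint union differently, so a third
  copy of the labels temporarily holds the \<open>N\<close>-part of the second operand. Two vertices of \<open>N\<close>
  coming from different operands are made adjacent immediately after the union, unless their labels
  will be joined later in the expression. For this reason the induction carries a relation \<open>M\<close> of
  label pairs that are joined in the future. The lower bounds follow because local
  complementation is an involution.
\<close>

section \<open>Unordered pairs and simple graphs\<close>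

lemma doubleton_mem_iff:
  "{u, v} \<in> {{a, b} | a b. P a b} \<longleftrightarrow> P u v \<or> P v u"
  by (auto simp: doubleton_eq_iff)

lemma simple_graphD:
  assumes "simple_graph (V, E)" "{u, v} \<in> E"
  shows "u \<in> V" "v \<in> V" "u \<noteq> v"
proof -
  obtain a b where "{u, v} = {a, b}" "a \<in> V" "b \<in> V" "a \<noteq> b"
    using assms unfolding simple_graph_def by fastforce
  then show "u \<in> V" "v \<in> V" "u \<noteq> v" by (auto simp: doubleton_eq_iff)
qed

text \<open>Edges of a simple graph are pairs of distinct vertices, so testing such pairs suffices.
  The main edge-set identities below are reduced to case analyses this way.\<close>

lemma simple_graph_edges_eqI:
  assumes "simple_graph (V, E)" "simple_graph (V, F)"
    and "\<And>u v. \<lbrakk>u \<in> V; v \<in> V; u \<noteq> v\<rbrakk> \<Longrightarrow> {u, v} \<in> E \<longleftrightarrow> {u, v} \<in> F"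
  shows "E = F"
proof (rule set_eqI)
  fix e
  show "e \<in> E \<longleftrightarrow> e \<in> F"
    using assms unfolding simple_graph_def by (simp, blast)
qed

lemma simple_graph_edge_setI:
  assumes "\<And>u v. P u v \<Longrightarrow> u \<in> V \<and> v \<in> V \<and> u \<noteq> v"
  shows "simple_graph (V, {{u, v} | u v. P u v})"
  using assms unfolding simple_graph_def by fastforce

lemma simple_graph_Un:
  assumes "simple_graph (V, E)" "simple_graph (W, F)"
  shows "simple_graph (V \<union> W, E \<union> F)"
  using assms unfolding simple_graph_def by (simp, blast)

lemma simple_graph_Un_edges:
  assumes "simple_graph (V, E)" "simple_graph (V, F)"
  shows "simple_graph (V, E \<union> F)"
  using simple_graph_Un[OF assms] by simp

subsection \<open>Complementation on a vertex set\<close>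

text \<open>The relation \<open>M\<close> is meant to be symmetric; it suppresses the new edges between
  vertices of \<open>N\<close> whose labels it relates.\<close>

definition twist :: "'a set \<Rightarrow> (nat \<times> nat) set \<Rightarrow> ('a \<Rightarrow> nat) \<Rightarrow> 'a set \<Rightarrow> 'a set set \<Rightarrow> 'a set set" where
  "twist N M lab V E =
     {{u, v} | u v. u \<in> V \<and> v \<in> V \<and> u \<noteq> v \<and>
        (if u \<in> N \<and> v \<in> N then {u, v} \<notin> E \<and> (lab u, lab v) \<notin> M else {u, v} \<in> E)}"

lemma mem_twist:
  assumes "sym M"
  shows "{u, v} \<in> twist N M lab V E \<longleftrightarrow> u \<in> V \<and> v \<in> V \<and> u \<noteq> v \<and>
     (if u \<in> N \<and> v \<in> N then {u, v} \<notin> E \<and> (lab u, lab v) \<notin> M else {u, v} \<in> E)"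
  using assms unfolding twist_def doubleton_mem_iff
  by (auto simp: insert_commute dest: symD)

lemma simple_graph_twist: "simple_graph (V, twist N M lab V E)"
  unfolding twist_def by (rule simple_graph_edge_setI) auto

text \<open>With \<open>M\<close> empty the labels have no influence, so \<open>lab\<close> is free:
  uses below take the labeling of the expression at hand, or \<open>undefined\<close>.\<close>

lemma LC_eq_twist: "LC G x = (verts G, twist (neighbors G x) {} lab (verts G) (edges G))"
  by (simp add: LC_def twist_def)

text \<open>Since there are no loops, \<open>x\<close> is not its own neighbor, so no pair
  containing \<open>x\<close> is complemented.\<close>

lemma neighbors_LC:
  assumes "simple_graph G"
  shows "neighbors (LC G x) x = neighbors G x"
proof -
  obtain V E where G: "G = (V, E)" by (cases G)
  have "x \<in> V \<and> x \<noteq> y" if "{x, y} \<in> E" for y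
    using assms simple_graphD[OF _ that] unfolding G by blast
  moreover from this[of x] have "x \<notin> neighbors G x"
    by (auto simp: G neighbors_def)
  ultimately show ?thesis
    unfolding LC_eq_twist[of G x undefined] neighbors_def
    by (auto simp: mem_twist sym_def G)
qed

text \<open>By \<open>neighbors_LC\<close> both complementations act on the same vertex set, and
  negating adjacency there twice restores it.\<close>

lemma LC_LC:
  assumes "simple_graph G"
  shows "LC (LC G x) x = G"
proof -
  obtain V E where G: "G = (V, E)" by (cases G)
  let ?N = "neighbors G x"
  have "LC (LC G x) x = (V, twist ?N {} undefined V (twist ?N {} undefined V E))"
    unfolding LC_eq_twist[of "LC G x" x undefined] neighbors_LC[OF assms]
    by (simp add: LC_eq_twist[of "(V, E)" x undefined] G)
  also have "twist ?N {} undefined V (twist ?N {} undefined V E) = E"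
    by (rule simple_graph_edges_eqI[OF simple_graph_twist])
       (use assms in \<open>auto simp: G mem_twist sym_def\<close>)
  finally show ?thesis by (simp add: G)
qed

lemma finite_simple_graph_LC: "finite_simple_graph G \<Longrightarrow> finite_simple_graph (LC G x)"
  by (simp add: finite_simple_graph_def LC_eq_twist[of G x undefined] simple_graph_twist)

subsection \<open>NLC-width\<close>

lemma NLC_labels: "NLC k G lab \<Longrightarrow> v \<in> verts G \<Longrightarrow> lab v \<in> {1..k}"
  by (induction rule: NLC.induct) (auto simp: Pi_iff)

lemma NLC_simple: "NLC k G lab \<Longrightarrow> simple_graph G"
proof (induction rule: NLC.induct)
  case (vertex lab v)
  then show ?case by (simp add: simple_graph_def)
next
  case (join V1 E1 lab1 V2 E2 lab2 S lab)
  show ?case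
    by (rule simple_graph_Un_edges[OF simple_graph_Un[OF join.IH]], rule simple_graph_edge_setI)
       (use join.hyps in auto)
qed

text \<open>Label \<open>i\<close> is kept outside \<open>N\<close> and becomes \<open>i + k\<close>
  inside \<open>N\<close>. Membership in \<open>N\<close> is thus readable at every join, which can
  then insert exactly the desired edges between its operands.\<close>

lemma NLC_twist:
  assumes "NLC k G lab"
  shows "NLC (2 * k) (verts G, twist N {} lab (verts G) (edges G))
           (\<lambda>v. lab v + (if v \<in> N then k else 0))"
  using assms
proof (induction rule: NLC.induct)
  case (vertex lab v)
  have "twist N {} lab {v} {} = {}" by (auto simp: twist_def)
  with vertex show ?case by (auto intro: NLC.vertex)
next
  case (join V1 E1 lab1 V2 E2 lab2 S lab)
  let ?l = "\<lambda>lab v. lab v + (if v \<in> N then k else (0::nat))"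
  let ?T1 = "twist N {} lab1 V1 E1" and ?T2 = "twist N {} lab2 V2 E2"
  let ?D = "{{u, v} | u v. u \<in> V1 \<and> v \<in> V2 \<and> (lab1 u, lab2 v) \<in> S}"
  let ?E = "E1 \<union> E2 \<union> ?D"
  \<comment> \<open>A label above \<open>k\<close> marks a vertex of \<open>N\<close>, and
    subtracting \<open>k\<close> recovers its old label. \<open>S\<close> is negated only when both
    labels are marked.\<close>
  define S' where "S' = {(p, q) \<in> {1..2*k} \<times> {1..2*k}.
      if k < p \<and> k < q then (p - k, q - k) \<notin> S
      else ((if k < p then p - k else p), (if k < q then q - k else q)) \<in> S}"
  let ?D' = "{{u, v} | u v. u \<in> V1 \<and> v \<in> V2 \<and> (?l lab1 u, ?l lab2 v) \<in> S'}"
  have l1: "lab1 u \<in> {1..k}" if "u \<in> V1" for u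
    using NLC_labels[OF join.hyps(1)] that by simp
  have l2: "lab2 u \<in> {1..k}" if "u \<in> V2" for u
    using NLC_labels[OF join.hyps(2)] that by simp
  have S': "(?l lab1 u, ?l lab2 v) \<in> S' \<longleftrightarrow>
      (if u \<in> N \<and> v \<in> N then (lab1 u, lab2 v) \<notin> S else (lab1 u, lab2 v) \<in> S)"
    if "u \<in> V1" "v \<in> V2" for u v
    using l1[OF that(1)] l2[OF that(2)] by (auto simp: S'_def)
  have D': "?D' = {{u, v} | u v. u \<in> V1 \<and> v \<in> V2 \<and>
      (if u \<in> N \<and> v \<in> N then (lab1 u, lab2 v) \<notin> S else (lab1 u, lab2 v) \<in> S)}"
    using S' by blast
  have sg: "simple_graph (V1, E1)" "simple_graph (V2, E2)"
    using join.hyps NLC_simple by blast+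
  have disj: "u \<notin> V2" if "u \<in> V1" for u using join.hyps that by auto
  have "NLC (2 * k) (V1 \<union> V2, ?T1 \<union> ?T2 \<union> ?D') (?l lab)"
    by (rule NLC.join) (use join in \<open>auto simp: S'_def\<close>)
  moreover have "twist N {} lab (V1 \<union> V2) ?E = ?T1 \<union> ?T2 \<union> ?D'"
  proof (rule simple_graph_edges_eqI[OF simple_graph_twist])
    show "simple_graph (V1 \<union> V2, ?T1 \<union> ?T2 \<union> ?D')"
      by (rule simple_graph_Un_edges[OF simple_graph_Un[OF simple_graph_twist simple_graph_twist]],
          rule simple_graph_edge_setI) (auto dest: disj)
    fix u v assume uv: "u \<in> V1 \<union> V2" "v \<in> V1 \<union> V2" "u \<noteq> v"
    have E1: "{a, b} \<in> E1 \<Longrightarrow> a \<in> V1 \<and> b \<in> V1" for a b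
      using sg(1) by (blast dest: simple_graphD)
    have E2: "{a, b} \<in> E2 \<Longrightarrow> a \<in> V2 \<and> b \<in> V2" for a b
      using sg(2) by (blast dest: simple_graphD)
    have sy: "sym {}" by (simp add: sym_def)
    \<comment> \<open>Pairs inside one operand are governed by its own twist, mixed pairs by
      \<open>?D'\<close> alone.\<close>
    consider "u \<in> V1" "v \<in> V1" "u \<notin> V2" "v \<notin> V2" | "u \<in> V2" "v \<in> V2" "u \<notin> V1" "v \<notin> V1"
      | "u \<in> V1" "v \<in> V2" "u \<notin> V2" "v \<notin> V1" | "u \<in> V2" "v \<in> V1" "u \<notin> V1" "v \<notin> V2"
      using uv disj by blast
    then show "{u, v} \<in> twist N {} lab (V1 \<union> V2) ?E \<longleftrightarrow> {u, v} \<in> ?T1 \<union> ?T2 \<union> ?D'"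
      unfolding D' unfolding Un_iff mem_twist[OF sy] doubleton_mem_iff
      by cases (use uv in \<open>auto dest: E1 E2\<close>)
  qed
  ultimately show ?case by simp
next
  case (relabel V E lab R lab')
  have l: "lab u \<in> {1..k}" if "u \<in> V" for u
    using NLC_labels[OF relabel.hyps(1)] that by simp
  have "twist N {} lab' V E = twist N {} lab V E" by (simp add: twist_def)
  moreover have "NLC (2 * k) (V, twist N {} lab V E) (\<lambda>v. lab' v + (if v \<in> N then k else 0))"
  \<comment> \<open>\<open>R\<close> acts on both copies of the labels in parallel, preserving the
    mark for \<open>N\<close>.\<close>
  proof (rule NLC.relabel[where R = "\<lambda>i. if k < i then R (i - k) + k else R i"])
    show "NLC (2 * k) (V, twist N {} lab V E) (\<lambda>v. lab v + (if v \<in> N then k else 0))"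
      using relabel.IH by simp
    have "R i \<in> {1..k}" if "i \<in> {1..k}" for i using relabel.hyps(2) that by blast
    from this[of "i - k" for i] this
    show "(\<lambda>i. if k < i then R (i - k) + k else R i) \<in> {1..2 * k} \<rightarrow> {1..2 * k}"
      by (fastforce simp: Suc_le_eq)
    fix v assume "v \<in> V"
    with l[of v] relabel.hyps(3)[of v]
    show "lab' v + (if v \<in> N then k else 0) =
      (if k < lab v + (if v \<in> N then k else 0) then R (lab v + (if v \<in> N then k else 0) - k) + k
       else R (lab v + (if v \<in> N then k else 0)))" by auto
  qed
  ultimately show ?case by simp
qed

text \<open>Vertices are added one at a time. As labels are distinct, a join can pick out exactly
  the neighbors of the new vertex.\<close>

lemma NLC_exists:
  assumes "finite V" "V \<noteq> {}" "simple_graph (V, E)" "inj_on lab V" "lab ` V \<subseteq> {1..k}"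
  shows "NLC k (V, E) lab"
  using assms
proof (induction arbitrary: E rule: finite_ne_induct)
  case (singleton x)
  then have "E = {}" by (auto simp: simple_graph_def)
  with singleton show ?case by (auto intro: NLC.vertex)
next
  case (insert x V)
  let ?E = "{{u, v} | u v. u \<in> V \<and> v \<in> V \<and> {u, v} \<in> E}"
  let ?S = "{(lab u, lab x) | u. u \<in> V \<and> {u, x} \<in> E}"
  let ?D = "{{u, v} | u v. u \<in> V \<and> v \<in> {x} \<and> (lab u, lab v) \<in> ?S}"
  have sg: "simple_graph (V, ?E)"
    by (rule simple_graph_edge_setI) (use simple_graphD[OF insert.prems(1)] in blast)
  have D: "(lab u, lab x) \<in> ?S \<longleftrightarrow> {u, x} \<in> E" if "u \<in> V" for u
    using insert.prems(2) that by (auto dest: inj_onD)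
  have "NLC k (V \<union> {x}, ?E \<union> {} \<union> ?D) lab"
  proof (rule NLC.join)
    show "NLC k (V, ?E) lab" using insert.IH[OF sg] insert.prems by simp
    show "NLC k ({x}, {}) lab" using insert.prems by (auto intro: NLC.vertex)
  qed (use insert.hyps insert.prems in auto)
  moreover have "?E \<union> {} \<union> ?D = E"
  proof (rule simple_graph_edges_eqI[of "V \<union> {x}"])
    show "simple_graph (V \<union> {x}, ?E \<union> {} \<union> ?D)"
    proof (rule simple_graph_Un_edges[OF simple_graph_Un[OF sg] simple_graph_edge_setI])
      show "simple_graph ({x}, {})" by (simp add: simple_graph_def)
    qed (use insert.hyps in auto)
    show "simple_graph (V \<union> {x}, E)" using insert.prems by simp
    fix u v assume uv: "u \<in> V \<union> {x}" "v \<in> V \<union> {x}" "u \<noteq> v"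
    have "?D = {{u, v} | u v. u \<in> V \<and> v = x \<and> {u, v} \<in> E}"
      using D by blast
    then show "{u, v} \<in> ?E \<union> {} \<union> ?D \<longleftrightarrow> {u, v} \<in> E"
      using uv by (simp only: Un_iff doubleton_mem_iff) (auto simp: insert_commute)
  qed
  ultimately show ?case by simp
qed

subsection \<open>Clique-width\<close>

text \<open>Labels are total functions, while composed relabelings agree with the intended labeling
  only on the vertices; this bridges the gap.\<close>

lemma CW_cong:
  assumes "CW k G lab" "\<And>v. v \<in> verts G \<Longrightarrow> lab' v = lab v"
  shows "CW k G lab'"
  using assms
proof (induction arbitrary: lab' rule: CW.induct)
  case (disjoint_union V1 E1 lab1 V2 E2 lab2 lab)
  then have "CW k (V1, E1) lab1" "CW k (V2, E2) lab2" by blast+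
  then show ?case by (rule CW.disjoint_union) (use disjoint_union in auto)
next
  case (relabel V E lab a b lab1)
  show ?case by (rule CW.relabel[OF relabel.hyps(1-4)]) (use relabel in auto)
next
  case (add_edges V E lab a b)
  have "{{u, v} | u v. u \<in> V \<and> v \<in> V \<and> lab u = a \<and> lab v = b} =
        {{u, v} | u v. u \<in> V \<and> v \<in> V \<and> lab' u = a \<and> lab' v = b}"
    using add_edges.prems by fastforce
  then show ?case using add_edges by (auto intro: CW.add_edges)
qed (auto intro: CW.vertex)

lemma CW_labels: "CW k G lab \<Longrightarrow> v \<in> verts G \<Longrightarrow> lab v \<in> {1..k}"
  by (induction rule: CW.induct) auto

lemma CW_simple: "CW k G lab \<Longrightarrow> simple_graph G"
proof (induction rule: CW.induct)
  case (vertex lab v)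
  then show ?case by (simp add: simple_graph_def)
next
  case (disjoint_union V1 E1 lab1 V2 E2 lab2 lab)
  show ?case by (rule simple_graph_Un) fact+
next
  case (add_edges V E lab a b)
  show ?case
    by (rule simple_graph_Un_edges[OF add_edges.IH], rule simple_graph_edge_setI)
       (use add_edges.hyps in auto)
qed

text \<open>Idempotence lets the single relabelings be performed one after the other, in any order.\<close>

lemma CW_relabel_idem:
  assumes cw: "CW k (V, E) lab" and R: "R \<in> {1..k} \<rightarrow> {1..k}"
    and idem: "\<And>a. a \<in> {1..k} \<Longrightarrow> R (R a) = R a"
  shows "CW k (V, E) (\<lambda>v. R (lab v))"
proof -
  have "CW k (V, E) (\<lambda>v. if lab v \<in> A then R (lab v) else lab v)"
    if "finite A" "A \<subseteq> {a \<in> {1..k}. R a \<noteq> a}" for A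
    using that
  proof (induction rule: finite_induct)
    case empty
    then show ?case using cw by simp
  next
    case (insert a A)
    then have IH: "CW k (V, E) (\<lambda>v. if lab v \<in> A then R (lab v) else lab v)" by simp
    show ?case
    \<comment> \<open>Labels moved earlier now sit at fixed points of \<open>R\<close>, hence differ
      from the non-fixed \<open>a\<close>. Only vertices originally labeled \<open>a\<close> are
      affected.\<close>
    proof (rule CW.relabel[OF IH, of a "R a"])
      fix v assume "v \<in> V"
      show "(if lab v \<in> insert a A then R (lab v) else lab v) =
        (if (if lab v \<in> A then R (lab v) else lab v) = a then R a
         else if lab v \<in> A then R (lab v) else lab v)"
        using insert.hyps insert.prems idem by auto
    qed (use insert R in auto)
  qed
  from this[of "{a \<in> {1..k}. R a \<noteq> a}"]
  have "CW k (V, E) (\<lambda>v. if lab v \<in> {a \<in> {1..k}. R a \<noteq> a} then R (lab v) else lab v)" by simp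
  then show ?thesis
    by (rule CW_cong) (use CW_labels[OF cw] in auto)
qed

lemma CW_add_edges_set:
  assumes "CW k (V, E) lab" "S \<subseteq> {1..k} \<times> {1..k}" "\<And>a. (a, a) \<notin> S"
  shows "CW k (V, E \<union> {{u, v} | u v. u \<in> V \<and> v \<in> V \<and> (lab u, lab v) \<in> S}) lab"
proof -
  have "finite S" using assms(2) finite_subset by blast
  then show ?thesis using assms
  proof (induction rule: finite_induct)
    case empty
    then show ?case by simp
  next
    case (insert s S)
    obtain a b where s: "s = (a, b)" by (cases s)
    let ?F = "\<lambda>S. {{u, v} | u v. u \<in> V \<and> v \<in> V \<and> (lab u, lab v) \<in> S}"
    have "CW k (V, E \<union> ?F S) lab" using insert by simp
    moreover have "a \<in> {1..k}" "b \<in> {1..k}" "a \<noteq> b" using insert.prems s by auto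
    ultimately have
      "CW k (V, (E \<union> ?F S) \<union> {{u, v} | u v. u \<in> V \<and> v \<in> V \<and> lab u = a \<and> lab v = b}) lab"
      by (rule CW.add_edges)
    moreover have "(E \<union> ?F S) \<union> {{u, v} | u v. u \<in> V \<and> v \<in> V \<and> lab u = a \<and> lab v = b}
        = E \<union> ?F (insert s S)"
      by (auto simp: s)
    ultimately show ?case by simp
  qed
qed

text \<open>No operation deletes edges, so an edge between vertices of \<open>N\<close> that
  \<open>G\<close> acquires later must never be inserted; this is why \<open>M\<close> is arbitrary
  in the induction. Passing to subexpressions, a union keeps \<open>M\<close>, a relabeling pulls it
  back, and an edge addition enlarges it. The resulting labels stay within \<open>2 * k\<close>; the
  third block serves only inside unions.\<close>

lemma CW_twist:
  assumes "CW k G lab" "sym M"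
  shows "CW (3 * k) (verts G, twist N M lab (verts G) (edges G))
           (\<lambda>v. lab v + (if v \<in> N then k else 0))"
  using assms
proof (induction arbitrary: M rule: CW.induct)
  case (vertex lab v)
  have "twist N M lab {v} {} = {}" by (auto simp: twist_def)
  with vertex show ?case by (auto intro: CW.vertex)
next
  case (disjoint_union V1 E1 lab1 V2 E2 lab2 lab)
  let ?l = "\<lambda>lab v. lab v + (if v \<in> N then k else (0::nat))"
  let ?T1 = "twist N M lab1 V1 E1" and ?T2 = "twist N M lab2 V2 E2"
  \<comment> \<open>\<open>?up\<close> moves the \<open>N\<close>-part of the second operand into
    the third block and \<open>?down\<close> brings it back. On labels up to \<open>3 * k\<close>
    both are idempotent, as \<open>CW_relabel_idem\<close> demands.\<close>
  let ?up = "\<lambda>i. if k < i \<and> i \<le> 2 * k then i + k else i"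
  let ?down = "\<lambda>i. if 2 * k < i then i - k else i"
  let ?m = "\<lambda>v. if v \<in> V1 then ?l lab1 v else ?up (?l lab2 v)"
  \<comment> \<open>The blocks are disjoint, so these pairs only join the \<open>N\<close>-part of
    the first operand to that of the second.\<close>
  define S where "S = {(k + i, 2 * k + j) | i j. i \<in> {1..k} \<and> j \<in> {1..k} \<and> (i, j) \<notin> M}"
  let ?D = "{{u, v} | u v. u \<in> V1 \<union> V2 \<and> v \<in> V1 \<union> V2 \<and> (?m u, ?m v) \<in> S}"
  have l1: "lab1 u \<in> {1..k}" if "u \<in> V1" for u
    using CW_labels[OF disjoint_union.hyps(1)] that by simp
  have l2: "lab2 u \<in> {1..k}" if "u \<in> V2" for u
    using CW_labels[OF disjoint_union.hyps(2)] that by simp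
  have disj: "u \<notin> V1" if "u \<in> V2" for u using disjoint_union.hyps that by auto
  have CW1: "CW (3 * k) (V1, ?T1) (?l lab1)" and CW2: "CW (3 * k) (V2, ?T2) (?l lab2)"
    using disjoint_union.IH[OF disjoint_union.prems] by simp_all
  have "CW (3 * k) (V2, ?T2) (\<lambda>v. ?up (?l lab2 v))"
    by (rule CW_relabel_idem[OF CW2]) auto
  with CW1 have "CW (3 * k) (V1 \<union> V2, ?T1 \<union> ?T2) ?m"
    by (rule CW.disjoint_union) (use disjoint_union.hyps(3) in auto)
  then have "CW (3 * k) (V1 \<union> V2, ?T1 \<union> ?T2 \<union> ?D) ?m"
    by (rule CW_add_edges_set) (auto simp: S_def)
  then have "CW (3 * k) (V1 \<union> V2, ?T1 \<union> ?T2 \<union> ?D) (\<lambda>v. ?down (?m v))"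
    by (rule CW_relabel_idem) auto
  then have CW3: "CW (3 * k) (V1 \<union> V2, ?T1 \<union> ?T2 \<union> ?D) (?l lab)"
  proof (rule CW_cong)
    fix v assume "v \<in> verts (V1 \<union> V2, ?T1 \<union> ?T2 \<union> ?D)"
    then consider "v \<in> V1" | "v \<in> V2" "v \<notin> V1" by auto
    then show "?l lab v = ?down (?m v)"
    proof cases
      case 1
      with l1[of v] disjoint_union.hyps(4)[of v] show ?thesis by auto
    next
      case 2
      with l2[of v] disjoint_union.hyps(5)[of v] show ?thesis by auto
    qed
  qed
  have S: "(?m u, ?m v) \<in> S \<longleftrightarrow>
      u \<in> V1 \<and> v \<in> V2 \<and> u \<in> N \<and> v \<in> N \<and> (lab u, lab v) \<notin> M"
    if uv: "u \<in> V1 \<union> V2" "v \<in> V1 \<union> V2" for u v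
  proof -
    have m1: "?m w = lab w + (if w \<in> N then k else 0)" "lab w \<in> {1..k}" if "w \<in> V1" for w
      using that disjoint_union.hyps(4)[of w] l1[of w] by auto
    have m2: "?m w = lab w + (if w \<in> N then 2 * k else 0)" "lab w \<in> {1..k}" if "w \<in> V2" for w
      using that disjoint_union.hyps(5)[of w] l2[of w] disj[of w] by auto
    consider "u \<in> V1" "v \<in> V1" "u \<notin> V2" "v \<notin> V2" | "u \<in> V2" "v \<in> V2" "u \<notin> V1" "v \<notin> V1"
      | "u \<in> V1" "v \<in> V2" "u \<notin> V2" "v \<notin> V1" | "u \<in> V2" "v \<in> V1" "u \<notin> V1" "v \<notin> V2"
      using uv disj by blast
    then show ?thesis
    proof cases
      case 1
      with m1[of u] m1[of v] show ?thesis unfolding S_def by simp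
    next
      case 2
      with m2[of u] m2[of v] show ?thesis unfolding S_def by simp
    next
      case 3
      with m1[of u] m2[of v] show ?thesis unfolding S_def by (auto split: if_splits)
    next
      case 4
      with m2[of u] m1[of v] show ?thesis unfolding S_def by simp
    qed
  qed
  have D: "?D = {{u, v} | u v. u \<in> V1 \<and> v \<in> V2 \<and> u \<in> N \<and> v \<in> N \<and> (lab u, lab v) \<notin> M}"
    using S by blast
  have sg: "simple_graph (V1, E1)" "simple_graph (V2, E2)"
    using disjoint_union.hyps CW_simple by blast+
  have "twist N M lab (V1 \<union> V2) (E1 \<union> E2) = ?T1 \<union> ?T2 \<union> ?D"
  proof (rule simple_graph_edges_eqI[OF simple_graph_twist CW_simple[OF CW3]])
    fix u v assume uv: "u \<in> V1 \<union> V2" "v \<in> V1 \<union> V2" "u \<noteq> v"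
    have E1: "{u, v} \<in> E1 \<Longrightarrow> u \<in> V1 \<and> v \<in> V1"
      using sg(1) by (blast dest: simple_graphD)
    have E2: "{u, v} \<in> E2 \<Longrightarrow> u \<in> V2 \<and> v \<in> V2"
      using sg(2) by (blast dest: simple_graphD)
    have L: "w \<in> V1 \<Longrightarrow> lab1 w = lab w" "w \<in> V2 \<Longrightarrow> lab2 w = lab w" for w
      using disjoint_union.hyps(4,5) by simp_all
    have M: "(lab v, lab u) \<in> M \<longleftrightarrow> (lab u, lab v) \<in> M"
      using symD[OF \<open>sym M\<close>] by blast
    consider "u \<in> V1" "v \<in> V1" "u \<notin> V2" "v \<notin> V2" | "u \<in> V2" "v \<in> V2" "u \<notin> V1" "v \<notin> V1"
      | "u \<in> V1" "v \<in> V2" "u \<notin> V2" "v \<notin> V1" | "u \<in> V2" "v \<in> V1" "u \<notin> V1" "v \<notin> V2"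
      using uv disj by blast
    then show "{u, v} \<in> twist N M lab (V1 \<union> V2) (E1 \<union> E2) \<longleftrightarrow> {u, v} \<in> ?T1 \<union> ?T2 \<union> ?D"
      unfolding D unfolding Un_iff mem_twist[OF \<open>sym M\<close>] doubleton_mem_iff
      by cases (use uv M in \<open>auto simp: L dest: E1 E2\<close>)
  qed
  with CW3 show ?case by simp
next
  case (relabel V E lab a b lab')
  let ?R = "\<lambda>i. if i = a then b else i"
  \<comment> \<open>Two labels will be joined later exactly when their images under the relabeling
    will be.\<close>
  let ?M = "{(i, j). (?R i, ?R j) \<in> M}"
  have l: "lab u \<in> {1..k}" if "u \<in> V" for u
    using CW_labels[OF relabel.hyps(1)] that by simp
  have "sym ?M" using relabel.prems by (auto simp: sym_def)
  from relabel.IH[OF this]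
  have IH: "CW (3 * k) (V, twist N ?M lab V E) (\<lambda>v. lab v + (if v \<in> N then k else 0))" by simp
  \<comment> \<open>Both copies of \<open>a\<close> move. Since \<open>a\<close> and
    \<open>b\<close> are distinct and at most \<open>k\<close>, the targets \<open>b\<close> and
    \<open>b + k\<close> are fixed, so \<open>?Q\<close> is idempotent.\<close>
  let ?Q = "\<lambda>i. if i = a then b else if i = a + k then b + k else i"
  have "CW (3 * k) (V, twist N ?M lab V E) (\<lambda>v. ?Q (lab v + (if v \<in> N then k else 0)))"
    by (rule CW_relabel_idem[OF IH]) (use relabel.hyps in auto)
  then have "CW (3 * k) (V, twist N ?M lab V E) (\<lambda>v. lab' v + (if v \<in> N then k else 0))"
  proof (rule CW_cong)
    fix v assume "v \<in> verts (V, twist N ?M lab V E)"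
    with l[of v] relabel.hyps(2,3) relabel.hyps(5)[of v]
    show "lab' v + (if v \<in> N then k else 0) = ?Q (lab v + (if v \<in> N then k else 0))" by auto
  qed
  moreover have "twist N M lab' V E = twist N ?M lab V E"
  proof (rule simple_graph_edges_eqI[OF simple_graph_twist simple_graph_twist])
    fix u v assume "u \<in> V" "v \<in> V"
    then have "(lab' u, lab' v) \<in> M \<longleftrightarrow> (lab u, lab v) \<in> ?M"
      using relabel.hyps(5) by simp
    then show "{u, v} \<in> twist N M lab' V E \<longleftrightarrow> {u, v} \<in> twist N ?M lab V E"
      unfolding mem_twist[OF \<open>sym M\<close>] mem_twist[OF \<open>sym ?M\<close>] by presburger
  qed
  ultimately show ?case by simp
next
  case (add_edges V E lab a b)
  let ?M = "M \<union> {(a, b), (b, a)}"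
  let ?l = "\<lambda>v. lab v + (if v \<in> N then k else (0::nat))"
  let ?F = "{{u, v} | u v. u \<in> V \<and> v \<in> V \<and> lab u = a \<and> lab v = b}"
  \<comment> \<open>The combination \<open>(a + k, b + k)\<close> is left out: such pairs lie in
    \<open>N\<close> and become adjacent in \<open>G\<close> here, so they must stay nonadjacent.
    The enlarged \<open>?M\<close> has already kept them so.\<close>
  let ?S = "{(a, b), (a + k, b), (a, b + k)}"
  let ?D = "{{u, v} | u v. u \<in> V \<and> v \<in> V \<and> (?l u, ?l v) \<in> ?S}"
  have l: "lab u \<in> {1..k}" if "u \<in> V" for u
    using CW_labels[OF add_edges.hyps(1)] that by simp
  have sy: "sym ?M" using add_edges.prems by (auto simp: sym_def)
  have "CW (3 * k) (V, twist N ?M lab V E) ?l" using add_edges.IH[OF sy] by simp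
  then have CW': "CW (3 * k) (V, twist N ?M lab V E \<union> ?D) ?l"
    by (rule CW_add_edges_set) (use add_edges.hyps in auto)
  have S: "(?l u, ?l v) \<in> ?S \<longleftrightarrow> lab u = a \<and> lab v = b \<and> \<not> (u \<in> N \<and> v \<in> N)"
    if "u \<in> V" "v \<in> V" for u v
    using l[OF that(1)] l[OF that(2)] add_edges.hyps(2,3) by auto
  have D: "?D = {{u, v} | u v. u \<in> V \<and> v \<in> V \<and> lab u = a \<and> lab v = b \<and> \<not> (u \<in> N \<and> v \<in> N)}"
    using S by blast
  have "twist N M lab V (E \<union> ?F) = twist N ?M lab V E \<union> ?D"
  proof (rule simple_graph_edges_eqI[OF simple_graph_twist CW_simple[OF CW']])
    fix u v assume "u \<in> V" "v \<in> V" "u \<noteq> v"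
    then show "{u, v} \<in> twist N M lab V (E \<union> ?F) \<longleftrightarrow> {u, v} \<in> twist N ?M lab V E \<union> ?D"
      unfolding D unfolding Un_iff mem_twist[OF \<open>sym M\<close>] mem_twist[OF sy] doubleton_mem_iff by auto
  qed
  with CW' show ?case by simp
qed

text \<open>Build the edgeless graph with distinct labels, then insert each edge through its own
  label pair.\<close>

lemma CW_exists:
  assumes "finite V" "V \<noteq> {}" "simple_graph (V, E)" "inj_on lab V" "lab ` V \<subseteq> {1..k}"
  shows "CW k (V, E) lab"
proof -
  have edgeless: "CW k (V, {}) lab"
    using assms(1,2,5)
  proof (induction rule: finite_ne_induct)
    case (singleton x)
    then show ?case by (auto intro: CW.vertex)
  next
    case (insert x V)
    have "CW k ({x} \<union> V, {} \<union> {}) lab"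
      by (rule CW.disjoint_union[of k _ _ lab _ _ lab]) (use insert in \<open>auto intro: CW.vertex\<close>)
    then show ?case by simp
  qed
  define S where "S = {(lab u, lab v) | u v. {u, v} \<in> E}"
  note E = simple_graphD[OF assms(3)]
  have S: "(lab u, lab v) \<in> S \<longleftrightarrow> {u, v} \<in> E" if "u \<in> V" "v \<in> V" for u v
  proof
    assume "(lab u, lab v) \<in> S"
    then obtain u' v' where "lab u = lab u'" "lab v = lab v'" "{u', v'} \<in> E"
      unfolding S_def by blast
    moreover from this have "u = u'" "v = v'"
      using that inj_onD[OF assms(4)] E by blast+
    ultimately show "{u, v} \<in> E" by simp
  qed (auto simp: S_def)
  have "CW k (V, {} \<union> {{u, v} | u v. u \<in> V \<and> v \<in> V \<and> (lab u, lab v) \<in> S}) lab"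
  proof (rule CW_add_edges_set[OF edgeless])
    show "S \<subseteq> {1..k} \<times> {1..k}" using E assms(5) unfolding S_def by blast
    show "(a, a) \<notin> S" for a
    proof
      assume "(a, a) \<in> S"
      then obtain u v where "lab u = lab v" "{u, v} \<in> E" unfolding S_def by auto
      with E[of u v] assms(4) show False by (auto dest: inj_onD)
    qed
  qed
  moreover have "{} \<union> {{u, v} | u v. u \<in> V \<and> v \<in> V \<and> (lab u, lab v) \<in> S} = E"
  proof -
    have "{{u, v} | u v. u \<in> V \<and> v \<in> V \<and> (lab u, lab v) \<in> S} =
        {{u, v} | u v. u \<in> V \<and> v \<in> V \<and> {u, v} \<in> E}"
      using S by blast
    also have "\<dots> = E"
      using assms(3) unfolding simple_graph_def by fastforce
    finally show ?thesis by simp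
  qed
  ultimately show ?thesis by simp
qed

subsection \<open>Bounds for a single local complementation\<close>

text \<open>Some expression must exist before \<open>LEAST\<close> says anything; numbering the
  vertices by \<open>{1..card V}\<close> gives one. The vertex \<open>x\<close> ensures that
  \<open>card V\<close> is positive.\<close>

lemma widths_attained:
  assumes "finite_simple_graph G" "x \<in> verts G"
  shows "nlcw G \<ge> 1 \<and> (\<exists>lab. NLC (nlcw G) G lab)" "cw G \<ge> 1 \<and> (\<exists>lab. CW (cw G) G lab)"
proof -
  obtain V E where G: "G = (V, E)" by (cases G)
  have V: "finite V" "V \<noteq> {}" "simple_graph (V, E)"
    using assms by (auto simp: G finite_simple_graph_def)
  then obtain lab where lab: "bij_betw lab V {1..card V}"
    using finite_same_card_bij[of V "{1..card V}"] by auto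
  then have "inj_on lab V" "lab ` V \<subseteq> {1..card V}" by (auto simp: bij_betw_def)
  with V have "NLC (card V) G lab" "CW (card V) G lab"
    unfolding G by (blast intro: NLC_exists CW_exists)+
  moreover have "card V \<ge> 1" using V by (simp add: Suc_le_eq card_gt_0_iff)
  ultimately have "\<exists>k. k \<ge> 1 \<and> (\<exists>lab. NLC k G lab)" "\<exists>k. k \<ge> 1 \<and> (\<exists>lab. CW k G lab)" by blast+
  then show "nlcw G \<ge> 1 \<and> (\<exists>lab. NLC (nlcw G) G lab)" "cw G \<ge> 1 \<and> (\<exists>lab. CW (cw G) G lab)"
    unfolding nlcw_def cw_def by (auto dest!: LeastI_ex)
qed

lemma nlcw_LC_le:
  assumes "finite_simple_graph G" "x \<in> verts G"
  shows "nlcw (LC G x) \<le> 2 * nlcw G"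
proof -
  obtain lab where k: "nlcw G \<ge> 1" and "NLC (nlcw G) G lab"
    using widths_attained(1)[OF assms] by blast
  then have "\<exists>lab. NLC (2 * nlcw G) (LC G x) lab"
    unfolding LC_eq_twist[of G x lab] using NLC_twist by blast
  with k show ?thesis by (subst nlcw_def) (auto intro: Least_le)
qed

lemma cw_LC_le:
  assumes "finite_simple_graph G" "x \<in> verts G"
  shows "cw (LC G x) \<le> 3 * cw G"
proof -
  obtain lab where k: "cw G \<ge> 1" and "CW (cw G) G lab"
    using widths_attained(2)[OF assms] by blast
  then have "\<exists>lab. CW (3 * cw G) (LC G x) lab"
    unfolding LC_eq_twist[of G x lab] using CW_twist[where M = "{}"] by (blast intro: symI)
  with k show ?thesis by (subst cw_def) (auto intro: Least_le)
qed

theorem theorem7: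
  fixes G :: "'a graph" and x :: 'a
  assumes "finite_simple_graph G" and "x \<in> verts G"
  shows "(1/2 * real (nlcw G) \<le> real (nlcw (LC G x)) \<and> real (nlcw (LC G x)) \<le> 2 * real (nlcw G)) \<and>
         (1/3 * real (cw G) \<le> real (cw (LC G x)) \<and> real (cw (LC G x)) \<le> 3 * real (cw G))"
proof -
  have "LC (LC G x) x = G" using assms by (simp add: LC_LC finite_simple_graph_def)
  moreover have "finite_simple_graph (LC G x)" "x \<in> verts (LC G x)"
    using assms finite_simple_graph_LC[of G x] by (simp_all add: LC_eq_twist[of G x undefined])
  \<comment> \<open>These are the upper bounds for \<open>LC G x\<close>, whose complementation at
    \<open>x\<close> is \<open>G\<close> again.\<close>
  ultimately have "nlcw G \<le> 2 * nlcw (LC G x)" "cw G \<le> 3 * cw (LC G x)"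
    using nlcw_LC_le cw_LC_le by metis+
  moreover note nlcw_LC_le[OF assms] cw_LC_le[OF assms]
  ultimately show ?thesis by linarith
qed

end
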